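(* Suppose that the vector fields $f$ and $g$, where $f(y)=Ky+g(y)$ on $\mathbb{R}^n$, both belong to $\mathcal H$ with the same $P$; that is, there is an invertible matrix $P$ such that $Pf'(y)P^{-1}=-f'(y)^{\intercal}$ and $Pg'(y)P^{-1}=-g'(y)^{\intercal}$ for all $y$. Then every SSEI method (special symplectic exponential integrator) for solving $y'=Ky+g(y)$ is volume preserving.
   Context: The ODE is $y'(t)=Ky(t)+g(y(t))=:f(y(t))$ on $\mathbb{R}^n$, where $K$ is a real $n\times n$ matrix with $|e^{hK}|\neq-1$ for $0<h<1$, and $g:\mathbb{R}^n\to\mathbb{R}^n$ is differentiable; $f$ is assumed divergence free. $|\cdot|$ denotes the determinant. $\mathcal H$ is the class of vector fields $f$ for which there exists an invertible matrix $P$ with $Pf'(y)P^{-1}=-f'(y)^{\intercal}$ for all $y$. SSEI method: let $c=(c_1,\dots,c_s)^{\intercal}$, $b=(b_1,\dots,b_s)^{\intercal}$, $A=(a_{ij})_{s\times s}$ be the coefficients of an $s$-stage Runge--Kutta method which is symplectic, i.e. $b_ia_{ij}+b_ja_{ji}-b_ib_j=0$ for all $i,j$, and satisfies $b_j\neq0$ for all $j$. The corresponding $s$-stage SSEI method with stepsize $h$ is the map $$\varphi_h(y)=e^{hK}y+h\sum_{i=1}^{s}b_ie^{(1-c_i)hK}g(k_i(y)),\qquad k_i(y)=e^{c_ihK}y+h\sum_{j=1}^{s}a_{ij}e^{(c_i-c_j)hK}g(k_j(y)),\quad i=1,\dots,s.$$ It is understood that the stage equations define $k_1,\dots,k_s$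 as differentiable functions of $y$ and that the $sn\times sn$ matrix with $n\times n$ blocks $\delta_{ij}I-h\,a_{ij}e^{(c_i-c_j)hK}g'(k_j)$ is invertible. The method is volume preserving if $|\varphi_h'(y)|=1$ for all $y$. *)

theory Defs
  imports "HOL-Analysis.Analysis"
begin

(* Multiplication and powers from the type class instances of vec are componentwise,
   so the powers here are iterated ( ** ). *)
definition mat_exp :: "real^'n^'n \<Rightarrow> real^'n^'n" where
  "mat_exp M = (\<Sum>k. (1 / fact k) *\<^sub>R (((**) M) ^^ k) (mat 1))"

definition divergence_free :: "(real^'n \<Rightarrow> real^'n) \<Rightarrow> bool" where
  "divergence_free f \<longleftrightarrow>
     (\<forall>y. f differentiable (at y)) \<and> (\<forall>y. trace (jacobian f (at y)) = 0)"

definition volume_preserving :: "(real^'n \<Rightarrow> real^'n) \<Rightarrow> bool" where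
  "volume_preserving \<phi> \<longleftrightarrow>
     (\<forall>y. \<phi> differentiable (at y)) \<and> (\<forall>y. det (jacobian \<phi> (at y)) = 1)"

definition class_H_with :: "real^'n^'n \<Rightarrow> (real^'n \<Rightarrow> real^'n) set" where
  "class_H_with P = {f. (\<forall>y. f differentiable (at y)) \<and>
     (\<forall>y. P ** jacobian f (at y) ** matrix_inv P = - transpose (jacobian f (at y)))}"

definition class_H :: "(real^'n \<Rightarrow> real^'n) set" where
  "class_H = (\<Union>P \<in> {P. invertible P}. class_H_with P)"

definition symplectic_RK :: "real^'s^'s \<Rightarrow> real^'s \<Rightarrow> bool" where
  "symplectic_RK A b \<longleftrightarrow>
     (\<forall>i j. b $ i * A $ i $ j + b $ j * A $ j $ i - b $ i * b $ j = 0)"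

definition SSEI_stages ::
  "real^'n^'n \<Rightarrow> (real^'n \<Rightarrow> real^'n) \<Rightarrow> real \<Rightarrow> real^'s^'s \<Rightarrow> real^'s
    \<Rightarrow> ('s \<Rightarrow> real^'n \<Rightarrow> real^'n) \<Rightarrow> bool" where
  "SSEI_stages K g h A c k \<longleftrightarrow>
     (\<forall>y i. k i y = mat_exp ((c $ i * h) *\<^sub>R K) *v y
        + h *\<^sub>R (\<Sum>j\<in>UNIV. A $ i $ j *\<^sub>R
            (mat_exp (((c $ i - c $ j) * h) *\<^sub>R K) *v g (k j y))))"

(* The sn x sn matrix with (i, j) block \<delta>_ij I - h a_ij e^{(c_i - c_j) h K} g'(k_j(y));
   the index (i, p) is row (or column) p of block row (or column) i. *)
definition SSEI_stage_matrix ::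
  "real^'n^'n \<Rightarrow> (real^'n \<Rightarrow> real^'n) \<Rightarrow> real \<Rightarrow> real^'s^'s \<Rightarrow> real^'s
    \<Rightarrow> ('s \<Rightarrow> real^'n \<Rightarrow> real^'n) \<Rightarrow> real^'n \<Rightarrow> real^('s \<times> 'n)^('s \<times> 'n)" where
  "SSEI_stage_matrix K g h A c k y =
     (\<chi> r q. ((if fst r = fst q then mat 1 else 0)
        - (h * A $ fst r $ fst q) *\<^sub>R
            (mat_exp (((c $ fst r - c $ fst q) * h) *\<^sub>R K) ** jacobian g (at (k (fst q) y))))
        $ snd r $ snd q)"

definition SSEI_map ::
  "real^'n^'n \<Rightarrow> (real^'n \<Rightarrow> real^'n) \<Rightarrow> real \<Rightarrow> real^'s \<Rightarrow> real^'s
    \<Rightarrow> ('s \<Rightarrow> real^'n \<Rightarrow> real^'n) \<Rightarrow> real^'n \<Rightarrow> real^'n" where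
  "SSEI_map K g h b c k y =
     mat_exp (h *\<^sub>R K) *v y
     + h *\<^sub>R (\<Sum>i\<in>UNIV. b $ i *\<^sub>R (mat_exp (((1 - c $ i) * h) *\<^sub>R K) *v g (k i y)))"

end

theory Submission
  imports Defs
begin

text \<open>
  Write \<open>E t = e\<^sup>t\<^sup>h\<^sup>K\<close>, \<open>J\<^sub>i = g'(k\<^sub>i)\<close> and \<open>D\<^sub>i = k\<^sub>i'\<close>.  Differentiating the scheme gives
  \<open>\<phi>' = E 1 (I + R D)\<close>, where \<open>R\<close> is the block row with entries \<open>h b\<^sub>i E(-c\<^sub>i) J\<^sub>i\<close> and the block
  column \<open>D\<close> solves \<open>S D = C\<close>; here \<open>S\<close> is the stage matrix and \<open>C\<close> the block column with entries
  \<open>E(c\<^sub>i)\<close>.  It has to be shown that \<open>E 1\<close> and \<open>I + R D\<close> both have determinant 1.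

  Subtracting the two relations in the hypothesis yields \<open>P K = - K\<^sup>T P\<close>, so \<open>P\<close> carries \<open>E t\<close>
  to \<open>E(-t)\<^sup>T\<close>.  Hence the determinant of \<open>E t\<close> equals that of its inverse, and it is positive because
  \<open>E t\<close> is a square: it is 1.

  For the second factor, the identity \<open>det (I + X Y) = det (I + Y X)\<close> for rectangular matrices
  (\<open>weinstein_aronszajn\<close>) moves the product \<open>R D\<close> from size \<open>n\<close> to size \<open>s n\<close>:
  \<open>det S det (I + R D) = det (S + S D R) = det (S + C R)\<close>.
  The blocks of \<open>T = S + C R\<close> are those of \<open>S\<close> with \<open>a\<^sub>i\<^sub>j\<close> replaced by \<open>a\<^sub>i\<^sub>j - b\<^sub>j\<close>, which
  symplecticity turns into \<open>- b\<^sub>j a\<^sub>j\<^sub>i / b\<^sub>i\<close>.  The weights \<open>b\<^sub>j / b\<^sub>i\<close> disappear under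
  conjugation with the block diagonal matrix of the \<open>b\<^sub>i P\<close>, and at the same time \<open>P\<close> turns
  \<open>E(c\<^sub>i - c\<^sub>j) J\<^sub>j\<close> into \<open>- (J\<^sub>j E(c\<^sub>j - c\<^sub>i))\<^sup>T\<close>.  So \<open>T\<close> is similar to the
  transpose of the matrix with blocks \<open>\<delta>\<^sub>i\<^sub>j I - h a\<^sub>i\<^sub>j J\<^sub>i E(c\<^sub>i - c\<^sub>j)\<close>.  This is \<open>S\<close> with the two
  factors \<open>E\<close> and \<open>J\<close> interchanged, and a second use of \<open>weinstein_aronszajn\<close> gives
  \<open>det T = det S\<close>.  Since \<open>det S\<close> is nonzero, it cancels.
\<close>

section \<open>Elementary matrix algebra\<close>

lemma matrix_mul_minus_left: "(- A) ** B = - (A ** B)"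
  for A :: "'a::ring_1^'n^'m"
  by (simp add: vec_eq_iff matrix_matrix_mult_def sum_negf)

lemma matrix_mul_minus_right: "A ** (- B) = - (A ** B)"
  for A :: "'a::ring_1^'n^'m"
  by (simp add: vec_eq_iff matrix_matrix_mult_def sum_negf)

lemma matrix_mul_zero [simp]: "A ** 0 = 0" "0 ** B = 0"
  for A :: "'a::semiring_1^'n^'m" and B :: "'a::semiring_1^'k^'n"
  by (simp_all add: vec_eq_iff matrix_matrix_mult_def)

lemma matrix_mul_sum_right: "A ** (\<Sum>i\<in>I. B i) = (\<Sum>i\<in>I. A ** B i)"
  for A :: "'a::semiring_1^'n^'m"
  by (simp add: vec_eq_iff matrix_matrix_mult_def sum_distrib_left sum.swap[of _ I])

lemma matrix_mul_add_left: "(A + B) ** C = A ** C + B ** C"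
  for A B :: "'a::semiring_1^'n^'m"
  by (simp add: vec_eq_iff matrix_matrix_mult_def sum.distrib distrib_right)

lemma matrix_mul_diff_left: "(A - B) ** C = A ** C - B ** C"
  for A B :: "'a::ring_1^'n^'m"
  by (simp add: vec_eq_iff matrix_matrix_mult_def sum_subtractf left_diff_distrib)

lemma matrix_mul_diff_right: "A ** (B - C) = A ** B - A ** C"
  for A :: "'a::ring_1^'n^'m"
  by (simp add: vec_eq_iff matrix_matrix_mult_def sum_subtractf right_diff_distrib)

lemma transpose_zero: "transpose 0 = 0"
  by (simp add: vec_eq_iff transpose_def)

lemma transpose_diff: "transpose (A - B) = transpose A - transpose B"
  by (simp add: vec_eq_iff transpose_def)

lemma transpose_add: "transpose (A + B) = transpose A + transpose B"
  by (simp add: vec_eq_iff transpose_def)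

lemma transpose_scaleR: "transpose (t *\<^sub>R A) = t *\<^sub>R transpose A"
  by (simp add: vec_eq_iff transpose_def)

lemma matrix_inv_mult_left:
  assumes "invertible A"
  shows "matrix_inv A ** A = mat 1"
proof -
  have "\<exists>B. A ** B = mat 1 \<and> B ** A = mat 1"
    using assms by (simp add: invertible_def)
  then show ?thesis
    unfolding matrix_inv_def by (rule someI2_ex) simp
qed

lemma scaleR_matrix_vector: "(t *\<^sub>R A) *v x = t *\<^sub>R (A *v x)" for A :: "real^'n^'m"
  by (simp add: vec_eq_iff matrix_vector_mult_def sum_distrib_left mult_ac)

lemma sum_matrix_vector: "(\<Sum>i\<in>I. A i) *v x = (\<Sum>i\<in>I. A i *v x)"
  for A :: "'i \<Rightarrow> 'a::semiring_1^'n^'m"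
  by (simp add: vec_eq_iff matrix_vector_mult_def sum_distrib_right sum.swap[of _ I])

section \<open>The determinant identity of Weinstein and Aronszajn\<close>

text \<open>
  In the Leibniz expansion only permutations that fix every index outside the range of \<open>e\<close>
  contribute, and these are the images under \<open>e\<close> of the permutations of the small index type;
  signs and products agree.  An arbitrary injection \<open>e\<close> treats both diagonal positions of a
  \<open>2 \<times> 2\<close> block matrix at once.
\<close>

lemma det_extend_by_identity:
  fixes W :: "'c::comm_ring_1^'a^'a" and e :: "'a \<Rightarrow> 'b::finite" and M :: "'c^'b^'b"
  assumes e: "inj e"
    and M: "\<And>i j. M $ e i $ e j = W $ i $ j"
    and M_id: "\<And>i j. i \<notin> range e \<Longrightarrow> M $ i $ j = (if i = j then 1 else 0)"
  shows "det M = det W"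
proof -
  let ?S = "\<lambda>p. of_int (sign p) * (\<Prod>i\<in>UNIV. M $ i $ p i)"
  have bij: "bij_betw e UNIV (range e)"
    using e by (simp add: bij_betw_def)
  have "det M = sum ?S {p. p permutes UNIV}"
    by (simp add: det_def)
  also have "\<dots> = sum ?S {p. p permutes range e}"
  proof (rule sum.mono_neutral_right)
    show "finite {p :: 'b \<Rightarrow> 'b. p permutes UNIV}" by simp
    show "{p. p permutes range e} \<subseteq> {p. p permutes UNIV}"
      using permutes_subset by blast
    show "\<forall>p\<in>{p. p permutes UNIV} - {p. p permutes range e}. ?S p = 0"
    proof
      fix p assume p: "p \<in> {p. p permutes UNIV} - {p. p permutes range e}"
      then obtain i where i: "i \<notin> range e" "p i \<noteq> i"
        unfolding permutes_def by blast
      then have "M $ i $ p i = 0" using M_id by metis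
      then have "(\<Prod>i\<in>UNIV. M $ i $ p i) = 0"
        by (intro prod_zero) auto
      then show "?S p = 0" by simp
    qed
  qed
  also have "\<dots> = sum (\<lambda>q. ?S (map_permutation UNIV e q)) {q. q permutes UNIV}"
  proof (rule sum.reindex_bij_witness[where i = "map_permutation UNIV e"
        and j = "map_permutation (range e) (inv_into UNIV e)"])
    fix p assume "p \<in> {p. p permutes range e}"
    then have p: "p permutes range e" by simp
    show "map_permutation UNIV e (map_permutation (range e) (inv_into UNIV e) p) = p"
      by (rule map_permutation_compose_inv[OF _ p])
        (use bij_betw_inv_into[OF bij] e in \<open>auto\<close>)
    then show "?S (map_permutation UNIV e (map_permutation (range e) (inv_into UNIV e) p)) = ?S p"
      by simp
    show "map_permutation (range e) (inv_into UNIV e) p \<in> {q. q permutes UNIV}"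
      using map_permutation_permutes[OF bij_betw_inv_into[OF bij] p] by simp
  next
    fix q :: "'a \<Rightarrow> 'a" assume "q \<in> {q. q permutes UNIV}"
    then have q: "q permutes UNIV" by simp
    show "map_permutation (range e) (inv_into UNIV e) (map_permutation UNIV e q) = q"
      by (rule map_permutation_compose_inv[OF bij q]) (use e in auto)
    show "map_permutation UNIV e q \<in> {p. p permutes range e}"
      using map_permutation_permutes[OF bij q] by simp
  qed
  also have "\<dots> = det W"
    unfolding det_def
  proof (rule sum.cong[OF refl])
    fix q :: "'a \<Rightarrow> 'a" assume "q \<in> {q. q permutes UNIV}"
    then have q: "q permutes UNIV" by simp
    let ?p = "map_permutation UNIV e q"
    have p: "?p permutes range e"
      using map_permutation_permutes[OF bij q] by simp
    have "(\<Prod>i\<in>UNIV. M $ i $ ?p i) = (\<Prod>i\<in>range e. M $ i $ ?p i)"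
      by (rule prod.mono_neutral_right)
        (use permutes_not_in[OF p] M_id in auto)
    also have "\<dots> = (\<Prod>i\<in>UNIV. W $ i $ q i)"
      using e by (simp add: prod.reindex map_permutation_apply M)
    finally show "?S ?p = of_int (sign q) * (\<Prod>i\<in>UNIV. W $ i $ q i)"
      using e q by (simp add: sign_map_permutation)
  qed
  finally show ?thesis .
qed

definition block2 :: "'c^'a^'a \<Rightarrow> 'c^'b^'a \<Rightarrow> 'c^'a^'b \<Rightarrow> 'c^'b^'b \<Rightarrow> 'c^('a + 'b)^('a + 'b)" where
  "block2 A B C D = (\<chi> i j. case i of
       Inl p \<Rightarrow> (case j of Inl q \<Rightarrow> A $ p $ q | Inr q \<Rightarrow> B $ p $ q)
     | Inr p \<Rightarrow> (case j of Inl q \<Rightarrow> C $ p $ q | Inr q \<Rightarrow> D $ p $ q))"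

lemma sum_UNIV_sum_type:
  fixes F :: "'a::finite + 'b::finite \<Rightarrow> 'c::comm_monoid_add"
  shows "(\<Sum>x\<in>UNIV. F x) = (\<Sum>a\<in>UNIV. F (Inl a)) + (\<Sum>b\<in>UNIV. F (Inr b))"
  by (simp add: UNIV_Plus_UNIV[symmetric] sum.Plus o_def del: UNIV_Plus_UNIV)

lemma block2_mult:
  "block2 A B C D ** block2 A' B' C' D' =
   block2 (A ** A' + B ** C') (A ** B' + B ** D') (C ** A' + D ** C') (C ** B' + D ** D')"
  by (auto simp: vec_eq_iff block2_def matrix_matrix_mult_def sum_UNIV_sum_type split: sum.splits)

lemma block2_one: "block2 (mat 1) 0 0 (mat 1) = mat 1"
  by (auto simp: vec_eq_iff block2_def mat_def split: sum.splits)

lemma det_block2_diag: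
  fixes U :: "'c::comm_ring_1^'a^'a" and W :: "'c^'b^'b"
  shows "det (block2 U 0 0 (mat 1 :: 'c^'b^'b)) = det U"
    and "det (block2 (mat 1 :: 'c^'a^'a) 0 0 W) = det W"
proof -
  show "det (block2 U 0 0 (mat 1 :: 'c^'b^'b)) = det U"
    by (rule det_extend_by_identity[where e = Inl])
      (auto simp: block2_def mat_def split: sum.splits)
  show "det (block2 (mat 1 :: 'c^'a^'a) 0 0 W) = det W"
    by (rule det_extend_by_identity[where e = Inr])
      (auto simp: block2_def mat_def split: sum.splits)
qed

text \<open>
  The matrices \<open>L C\<close> with lower left block \<open>C\<close> form a group with \<open>L X L Y = L (X + Y)\<close>.
  Conjugation with \<open>diag (I, - I)\<close> maps \<open>L C\<close> to its inverse \<open>L (- C)\<close>, so the determinant is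
  \<open>1\<close> or \<open>- 1\<close>; and \<open>L C\<close> is the square of \<open>L (C / 2)\<close>, so it is not negative.
\<close>

lemma det_block2_lower_unitriangular:
  fixes C :: "real^'a^'b"
  shows "det (block2 (mat 1) 0 C (mat 1)) = 1"
proof -
  let ?L = "\<lambda>C :: real^'a^'b. block2 (mat 1) 0 C (mat 1)"
  let ?D = "block2 (mat 1) 0 0 (- mat 1) :: real^('a + 'b)^('a + 'b)"
  have mult: "?L X ** ?L Y = ?L (X + Y)" for X Y
    by (simp add: block2_mult)
  have "?D ** ?D = mat 1"
    by (simp add: block2_mult matrix_mul_minus_left matrix_mul_minus_right block2_one)
  then have D: "det ?D * det ?D = 1"
    by (metis det_I det_mul)
  have "?L (- C) = ?D ** ?L C ** ?D"
    by (simp add: block2_mult matrix_mul_minus_left matrix_mul_minus_right)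
  then have "det (?L (- C)) = det ?D * det (?L C) * det ?D"
    by (simp only: det_mul)
  also have "\<dots> = (det ?D * det ?D) * det (?L C)"
    by (simp only: mult_ac)
  finally have neg: "det (?L (- C)) = det (?L C)"
    by (simp only: D mult_1_left)
  have "det (?L C) * det (?L (- C)) = det (?L C ** ?L (- C))"
    by (simp only: det_mul)
  also have "\<dots> = 1"
    by (simp only: mult) (simp add: block2_one)
  finally have sq: "det (?L C) * det (?L C) = 1"
    by (simp only: neg)
  have "(1/2) *\<^sub>R C + (1/2) *\<^sub>R C = C"
    by (simp flip: scaleR_add_left)
  then have "det (?L C) = det (?L ((1/2) *\<^sub>R C) ** ?L ((1/2) *\<^sub>R C))"
    by (simp only: mult)
  then have "det (?L C) \<ge> 0" by (simp only: det_mul zero_le_square)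
  moreover have "det (?L C) = 1 \<or> det (?L C) = - 1"
    using sq by (simp only: square_eq_1_iff)
  ultimately show ?thesis by linarith
qed

lemma block2_transpose:
  "transpose (block2 A B C D) = block2 (transpose A) (transpose C) (transpose B) (transpose D)"
  by (auto simp: vec_eq_iff block2_def transpose_def split: sum.splits)

lemma det_block2_upper_unitriangular:
  fixes B :: "real^'b^'a"
  shows "det (block2 (mat 1) B 0 (mat 1)) = 1"
proof -
  have "transpose (block2 (mat 1) B 0 (mat 1)) = block2 (mat 1) 0 (transpose B) (mat 1)"
    by (simp add: block2_transpose transpose_zero)
  then show ?thesis
    by (metis det_block2_lower_unitriangular det_transpose)
qed

text \<open>
  The matrix with rows \<open>(I, U)\<close> and \<open>(- X, I)\<close> has two block factorizations into triangular
  factors, one for each choice of the pivot block.  The Schur complements are \<open>I + X U\<close> and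
  \<open>I + U X\<close>.
\<close>

lemma weinstein_aronszajn:
  fixes U :: "real^'b^'a" and X :: "real^'a^'b"
  shows "det (mat 1 + U ** X) = det (mat 1 + X ** U)"
proof -
  let ?M = "block2 (mat 1) U (- X) (mat 1)"
  have "?M = block2 (mat 1) 0 (- X) (mat 1) ** block2 (mat 1) 0 0 (mat 1 + X ** U)
      ** block2 (mat 1) U 0 (mat 1)"
    by (simp add: block2_mult matrix_mul_minus_left)
  then have 1: "det ?M = det (mat 1 + X ** U)"
    by (simp add: det_mul det_block2_diag det_block2_lower_unitriangular
        det_block2_upper_unitriangular)
  have "?M = block2 (mat 1) U 0 (mat 1) ** block2 (mat 1 + U ** X) 0 0 (mat 1)
      ** block2 (mat 1) 0 (- X) (mat 1)"
    by (simp add: block2_mult matrix_mul_minus_right)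
  then have "det ?M = det (mat 1 + U ** X)"
    by (simp add: det_mul det_block2_diag det_block2_lower_unitriangular
        det_block2_upper_unitriangular)
  with 1 show ?thesis by simp
qed

section \<open>The matrix exponential\<close>

abbreviation mat_pow :: "real^'n^'n \<Rightarrow> nat \<Rightarrow> real^'n^'n" where
  "mat_pow M k \<equiv> (((**) M) ^^ k) (mat 1)"

lemma mat_pow_add: "mat_pow M (j + k) = mat_pow M j ** mat_pow M k"
  by (induction j) (simp_all add: matrix_mul_assoc)

lemma mat_pow_intertwine:
  assumes "P ** M = N ** P"
  shows "P ** mat_pow M k = mat_pow N k ** P"
proof (induction k)
  case (Suc k)
  have "P ** mat_pow M (Suc k) = (P ** M) ** mat_pow M k"
    by (simp add: matrix_mul_assoc)
  also have "\<dots> = N ** (P ** mat_pow M k)"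
    by (simp add: assms matrix_mul_assoc)
  finally show ?case by (simp add: Suc matrix_mul_assoc)
qed simp

lemma mat_pow_scaleR: "mat_pow (t *\<^sub>R M) k = t ^ k *\<^sub>R mat_pow M k"
  by (induction k) (simp_all add: scalar_matrix_assoc matrix_scalar_ac mult.commute)

lemma mat_pow_commute: "M ** mat_pow M k = mat_pow M k ** M"
  by (rule mat_pow_intertwine) simp

lemma mat_pow_transpose: "transpose (mat_pow M k) = mat_pow (transpose M) k"
  by (induction k) (simp_all add: matrix_transpose_mul flip: mat_pow_commute)

text \<open>
  The sum of the absolute values of all entries dominates every row sum, so it bounds the entries
  of powers geometrically.  With this bound the exponential series can be handled entry by entry,
  as an absolutely convergent real series.
\<close>

lemma abs_mat_pow_le:
  "\<bar>mat_pow M k $ p $ q\<bar> \<le> (\<Sum>i\<in>UNIV. \<Sum>j\<in>UNIV. \<bar>M $ i $ j\<bar>) ^ k"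
proof (induction k arbitrary: p)
  case 0
  show ?case by (simp add: mat_def)
next
  case (Suc k)
  let ?B = "\<Sum>i\<in>UNIV. \<Sum>j\<in>UNIV. \<bar>M $ i $ j\<bar>"
  have "\<bar>mat_pow M (Suc k) $ p $ q\<bar> \<le> (\<Sum>r\<in>UNIV. \<bar>M $ p $ r\<bar> * \<bar>mat_pow M k $ r $ q\<bar>)"
    by (simp add: matrix_matrix_mult_def flip: abs_mult)
  also have "\<dots> \<le> (\<Sum>r\<in>UNIV. \<bar>M $ p $ r\<bar> * ?B ^ k)"
    by (intro sum_mono mult_left_mono Suc) auto
  also have "\<dots> = (\<Sum>r\<in>UNIV. \<bar>M $ p $ r\<bar>) * ?B ^ k"
    by (simp add: sum_distrib_right)
  also have "\<dots> \<le> ?B * ?B ^ k"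
    by (intro mult_right_mono member_le_sum[of p UNIV "\<lambda>i. \<Sum>j\<in>UNIV. \<bar>M $ i $ j\<bar>"])
      (auto intro!: sum_nonneg zero_le_power)
  finally show ?case by simp
qed

lemma summable_mat_exp_entry: "summable (\<lambda>k. \<bar>1 / fact k * mat_pow M k $ p $ q\<bar>)"
proof (rule summable_comparison_test')
  let ?B = "\<Sum>i\<in>UNIV. \<Sum>j\<in>UNIV. \<bar>M $ i $ j\<bar>"
  show "summable (\<lambda>k. inverse (fact k) * ?B ^ k)"
    by (rule summable_exp)
  fix k
  show "norm \<bar>1 / fact k * mat_pow M k $ p $ q\<bar> \<le> inverse (fact k) * ?B ^ k"
    using mult_left_mono[OF abs_mat_pow_le[where M = M and k = k and p = p and q = q],
        of "inverse (fact k)"]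
    by (simp add: abs_mult inverse_eq_divide)
qed

lemma mat_exp_sums: "(\<lambda>k. (1 / fact k) *\<^sub>R mat_pow M k) sums mat_exp M"
proof -
  have "(\<lambda>k. (1 / fact k) *\<^sub>R mat_pow M k) sums
      (\<chi> p q. \<Sum>k. 1 / fact k * mat_pow M k $ p $ q)"
    unfolding sums_def
  proof (intro vec_tendstoI)
    fix p q
    have "(\<lambda>n. \<Sum>k<n. 1 / fact k * mat_pow M k $ p $ q)
        \<longlonglongrightarrow> (\<Sum>k. 1 / fact k * mat_pow M k $ p $ q)"
      by (rule summable_LIMSEQ[OF summable_rabs_cancel[OF summable_mat_exp_entry]])
    then show "(\<lambda>n. (\<Sum>k<n. (1 / fact k) *\<^sub>R mat_pow M k) $ p $ q) \<longlonglongrightarrow>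
        (\<chi> p q. \<Sum>k. 1 / fact k * mat_pow M k $ p $ q) $ p $ q"
      by simp
  qed
  then have "(\<lambda>k. (1 / fact k) *\<^sub>R mat_pow M k) sums (\<Sum>k. (1 / fact k) *\<^sub>R mat_pow M k)"
    by (rule sums_summable[THEN summable_sums])
  then show ?thesis by (simp only: mat_exp_def)
qed

lemma mat_exp_nth: "mat_exp M $ p $ q = (\<Sum>k. 1 / fact k * mat_pow M k $ p $ q)"
proof -
  have "(\<lambda>k. ((1 / fact k) *\<^sub>R mat_pow M k) $ p $ q) sums (mat_exp M $ p $ q)"
    by (intro sums_vec_nth mat_exp_sums)
  then have "(\<lambda>k. 1 / fact k * mat_pow M k $ p $ q) sums (mat_exp M $ p $ q)"
    by (simp only: vector_scaleR_component real_scaleR_def)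
  then show ?thesis by (rule sums_unique)
qed

text \<open>
  Each entry of the product is a finite sum of Cauchy products of real series, and the binomial
  theorem identifies the resulting coefficients.
\<close>

lemma mat_exp_add: "mat_exp ((s + t) *\<^sub>R M) = mat_exp (s *\<^sub>R M) ** mat_exp (t *\<^sub>R M)"
proof -
  have "mat_exp ((s + t) *\<^sub>R M) $ p $ q = (mat_exp (s *\<^sub>R M) ** mat_exp (t *\<^sub>R M)) $ p $ q" for p q
  proof -
    define a where "a u p q k = 1 / fact k * mat_pow (u *\<^sub>R M) k $ p $ q"
      for u :: real and p q k
    have "(\<lambda>k. \<Sum>r\<in>UNIV. \<Sum>i\<le>k. a s p r i * a t r q (k - i)) sums
        (\<Sum>r\<in>UNIV. (\<Sum>k. a s p r k) * (\<Sum>k. a t r q k))"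
      unfolding a_def
      by (intro sums_sum Cauchy_product_sums)
        (use summable_mat_exp_entry in \<open>simp_all only: real_norm_def\<close>)
    also have "(\<Sum>r\<in>UNIV. (\<Sum>k. a s p r k) * (\<Sum>k. a t r q k)) =
        (mat_exp (s *\<^sub>R M) ** mat_exp (t *\<^sub>R M)) $ p $ q"
      by (simp add: matrix_matrix_mult_def mat_exp_nth a_def)
    also have "(\<lambda>k. \<Sum>r\<in>UNIV. \<Sum>i\<le>k. a s p r i * a t r q (k - i)) = a (s + t) p q"
    proof
      fix k
      have "(\<Sum>r\<in>UNIV. \<Sum>i\<le>k. a s p r i * a t r q (k - i)) =
          (\<Sum>i\<le>k. \<Sum>r\<in>UNIV. a s p r i * a t r q (k - i))"
        by (rule sum.swap)
      also have "\<dots> = (\<Sum>i\<le>k. 1 / fact k * (of_nat (k choose i) * s ^ i * t ^ (k - i))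
          * mat_pow M k $ p $ q)"
      proof (rule sum.cong[OF refl])
        fix i assume "i \<in> {..k}"
        then have i: "i \<le> k" by simp
        have "(\<Sum>r\<in>UNIV. a s p r i * a t r q (k - i)) =
            s ^ i / fact i * (t ^ (k - i) / fact (k - i)) *
            (mat_pow M i ** mat_pow M (k - i)) $ p $ q"
          by (simp add: a_def mat_pow_scaleR matrix_matrix_mult_def sum_distrib_left mult_ac)
        also have "mat_pow M i ** mat_pow M (k - i) = mat_pow M k"
          using i by (simp flip: mat_pow_add)
        finally show "(\<Sum>r\<in>UNIV. a s p r i * a t r q (k - i)) =
            1 / fact k * (of_nat (k choose i) * s ^ i * t ^ (k - i)) * mat_pow M k $ p $ q"
          using i by (simp add: binomial_fact mult_ac)
      qed
      also have "\<dots> = a (s + t) p q k"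
        by (simp add: a_def mat_pow_scaleR binomial_ring sum_distrib_left sum_distrib_right mult_ac)
      finally show "(\<Sum>r\<in>UNIV. \<Sum>i\<le>k. a s p r i * a t r q (k - i)) = a (s + t) p q k" .
    qed
    finally have "a (s + t) p q sums (mat_exp (s *\<^sub>R M) ** mat_exp (t *\<^sub>R M)) $ p $ q" .
    then have "(mat_exp (s *\<^sub>R M) ** mat_exp (t *\<^sub>R M)) $ p $ q = (\<Sum>k. a (s + t) p q k)"
      by (rule sums_unique)
    then show ?thesis by (simp add: mat_exp_nth a_def)
  qed
  then show ?thesis by (simp add: vec_eq_iff)
qed

lemma mat_exp_zero: "mat_exp 0 = mat 1"
proof -
  have "(1 / fact k) *\<^sub>R mat_pow (0 :: real^'n^'n) k = (if k = 0 then mat 1 else 0)" for k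
    by (cases k) (simp_all add: vec_eq_iff matrix_matrix_mult_def)
  then have "mat_exp (0 :: real^'n^'n) = (\<Sum>k. if k = 0 then mat 1 else 0)"
    unfolding mat_exp_def by (rule suminf_cong)
  also have "\<dots> = mat 1"
    by (rule sums_unique[symmetric, OF sums_single])
  finally show ?thesis .
qed

lemma mat_exp_intertwine:
  fixes P :: "real^'n^'n"
  assumes "P ** M = N ** P"
  shows "P ** mat_exp M = mat_exp N ** P"
proof -
  have mult_linear: "linear (\<lambda>X. P ** X)" "linear (\<lambda>X. X ** P)"
    by (auto intro!: linearI simp: matrix_add_ldistrib vec_eq_iff matrix_matrix_mult_def
        sum_distrib_left algebra_simps sum.distrib)
  have "(\<lambda>k. P ** ((1 / fact k) *\<^sub>R mat_pow M k)) sums (P ** mat_exp M)"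
    using bounded_linear.sums[OF linear_conv_bounded_linear[THEN iffD1, OF mult_linear(1)] mat_exp_sums] .
  moreover have "P ** ((1 / fact k) *\<^sub>R mat_pow M k) = ((1 / fact k) *\<^sub>R mat_pow N k) ** P" for k
    by (metis mat_pow_intertwine[OF assms] matrix_scalar_ac scalar_matrix_assoc)
  moreover have "(\<lambda>k. ((1 / fact k) *\<^sub>R mat_pow N k) ** P) sums (mat_exp N ** P)"
    using bounded_linear.sums[OF linear_conv_bounded_linear[THEN iffD1, OF mult_linear(2)] mat_exp_sums] .
  ultimately show ?thesis by (simp add: sums_unique2)
qed

lemma mat_exp_transpose: "transpose (mat_exp M) = mat_exp (transpose M)"
proof -
  have "transpose (mat_exp M) $ p $ q = mat_exp (transpose M) $ p $ q" for p q
    by (simp add: transpose_def mat_exp_nth[of "transpose M", unfolded transpose_def]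
        mat_exp_nth[of M] flip: mat_pow_transpose[unfolded transpose_def])
  then show ?thesis by (simp add: vec_eq_iff)
qed

text \<open>
  The hypothesis says that \<open>K\<close> is skew for the bilinear form with matrix \<open>P\<close>; its exponentials are
  then isometries of this form.
\<close>

lemma mat_exp_conj:
  fixes K P :: "real^'n^'n"
  assumes "P ** K = - transpose K ** P"
  shows "P ** mat_exp (t *\<^sub>R K) = transpose (mat_exp ((- t) *\<^sub>R K)) ** P"
proof -
  have "P ** (t *\<^sub>R K) = t *\<^sub>R (P ** K)"
    by (simp add: matrix_scalar_ac scalar_matrix_assoc)
  also have "\<dots> = (t *\<^sub>R (- transpose K)) ** P"
    by (simp only: assms scalar_matrix_assoc)
  also have "t *\<^sub>R (- transpose K) = transpose ((- t) *\<^sub>R K)"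
    by (simp add: vec_eq_iff transpose_def)
  finally have "P ** (t *\<^sub>R K) = transpose ((- t) *\<^sub>R K) ** P" .
  then show ?thesis
    by (simp add: mat_exp_intertwine mat_exp_transpose)
qed

text \<open>
  Taking determinants in \<open>mat_exp_conj\<close> shows that \<open>e\<^sup>t\<^sup>K\<close> and its inverse have the same
  determinant, which is therefore \<open>1\<close> or \<open>- 1\<close>; the square root \<open>e\<^sup>t\<^sup>K\<^sup>/\<^sup>2\<close> excludes
  \<open>- 1\<close>.
\<close>

lemma det_mat_exp_eq_1:
  fixes K P :: "real^'n^'n"
  assumes "invertible P" and "P ** K = - transpose K ** P"
  shows "det (mat_exp (t *\<^sub>R K)) = 1"
proof -
  let ?e = "\<lambda>t. det (mat_exp (t *\<^sub>R K))"
  have add: "?e (s + t) = ?e s * ?e t" for s t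
    by (simp add: mat_exp_add det_mul)
  have "?e t * ?e (- t) = 1"
    using add[of t "- t"] by (simp add: mat_exp_zero)
  moreover have "det P * ?e t = ?e (- t) * det P"
    using arg_cong[OF mat_exp_conj[OF assms(2), of t], of det] by (simp add: det_mul)
  then have "?e t = ?e (- t)"
    using assms(1) by (simp add: invertible_det_nz)
  ultimately have "?e t * ?e t = 1" by simp
  then have "?e t = 1 \<or> ?e t = - 1" by (simp only: square_eq_1_iff)
  moreover have "?e t \<ge> 0"
    using add[of "t / 2" "t / 2"] by simp
  ultimately show ?thesis by linarith
qed

section \<open>Matrices of square blocks\<close>

definition block_matrix :: "('s::finite \<Rightarrow> 's \<Rightarrow> 'a^'n^'n) \<Rightarrow> 'a^('s \<times> 'n)^('s \<times> 'n)" where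
  "block_matrix F = (\<chi> r q. F (fst r) (fst q) $ snd r $ snd q)"

definition block_diag :: "('s::finite \<Rightarrow> 'a::zero^'n^'n) \<Rightarrow> 'a^('s \<times> 'n)^('s \<times> 'n)" where
  "block_diag D = block_matrix (\<lambda>i j. if i = j then D i else 0)"

definition block_column :: "('s::finite \<Rightarrow> 'a^'n^'n) \<Rightarrow> 'a^'n^('s \<times> 'n)" where
  "block_column C = (\<chi> r q. C (fst r) $ snd r $ q)"

definition block_row :: "('s::finite \<Rightarrow> 'a^'n^'n) \<Rightarrow> 'a^('s \<times> 'n)^'n" where
  "block_row R = (\<chi> r q. R (fst q) $ r $ snd q)"

lemma sum_UNIV_prod_type:
  fixes F :: "'s::finite \<times> 'n::finite \<Rightarrow> 'c::comm_monoid_add"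
  shows "(\<Sum>r\<in>UNIV. F r) = (\<Sum>i\<in>UNIV. \<Sum>p\<in>UNIV. F (i, p))"
  by (simp add: sum.cartesian_product)

lemma block_matrix_mult:
  "block_matrix F ** block_matrix G = block_matrix (\<lambda>i j. \<Sum>l\<in>UNIV. F i l ** G l j)"
  by (simp add: vec_eq_iff block_matrix_def matrix_matrix_mult_def sum_UNIV_prod_type)

lemma block_matrix_mult_column:
  "block_matrix F ** block_column C = block_column (\<lambda>i. \<Sum>l\<in>UNIV. F i l ** C l)"
  by (simp add: vec_eq_iff block_matrix_def block_column_def matrix_matrix_mult_def
      sum_UNIV_prod_type)

lemma block_column_mult_row:
  "block_column C ** block_row R = block_matrix (\<lambda>i j. C i ** R j)"
  by (simp add: vec_eq_iff block_matrix_def block_column_def block_row_def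
      matrix_matrix_mult_def)

lemma block_row_mult_column:
  "block_row R ** block_column C = (\<Sum>i\<in>UNIV. R i ** C i)"
  by (simp add: vec_eq_iff block_column_def block_row_def matrix_matrix_mult_def
      sum_UNIV_prod_type)

lemma block_matrix_add: "block_matrix F + block_matrix G = block_matrix (\<lambda>i j. F i j + G i j)"
  by (simp add: vec_eq_iff block_matrix_def)

lemma transpose_block_matrix:
  "transpose (block_matrix F) = block_matrix (\<lambda>i j. transpose (F j i))"
  by (simp add: vec_eq_iff block_matrix_def transpose_def)

lemma block_diag_mult:
  fixes D :: "'s::finite \<Rightarrow> 'a::semiring_1^'n^'n"
  shows "block_diag D ** block_matrix F = block_matrix (\<lambda>i j. D i ** F i j)"
    and "block_matrix F ** block_diag D = block_matrix (\<lambda>i j. F i j ** D j)"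
  by (simp_all add: block_diag_def block_matrix_mult if_distrib[where f = "\<lambda>X. X ** _"]
      if_distrib[where f = "\<lambda>X. _ ** X"] cong: if_cong)

lemma block_diag_one: "block_diag (\<lambda>_. mat 1) = mat 1"
  by (auto simp: vec_eq_iff block_diag_def block_matrix_def mat_def)

lemma mat_one_plus_block_matrix:
  "mat 1 + block_matrix F = block_matrix (\<lambda>i j. (if i = j then mat 1 else 0) + F i j)"
  by (simp add: block_diag_one[symmetric] block_diag_def block_matrix_add)

section \<open>Elimination of the stages\<close>

text \<open>
  The algebraic core, with \<open>E t\<close> in the role of \<open>e\<^sup>t\<^sup>h\<^sup>K\<close>, \<open>J i\<close> in that of \<open>g'(k\<^sub>i)\<close> and \<open>D i\<close> in
  that of \<open>k\<^sub>i'\<close>, so that the last hypothesis is the linearized stage equation.  By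
  \<open>weinstein_aronszajn\<close> the determinant of the linearized step is a quotient \<open>det T / det S\<close> of
  determinants of size \<open>s n\<close>.  Symplecticity makes \<open>T\<close> similar to the transpose of \<open>S'\<close>, which is
  \<open>S\<close> with the factors of each block interchanged.
\<close>

lemma det_symplectic_stage_elimination:
  fixes E :: "real \<Rightarrow> real^'n^'n" and J D :: "'s::finite \<Rightarrow> real^'n^'n"
    and P :: "real^'n^'n" and A :: "real^'s^'s" and b c :: "real^'s"
  assumes E_add: "\<And>s t. E (s + t) = E s ** E t"
    and P_inv: "invertible P"
    and P_E: "\<And>t. P ** E t = transpose (E (- t)) ** P"
    and P_J: "\<And>i. P ** J i = - transpose (J i) ** P"
    and sympl: "symplectic_RK A b" and b_nz: "\<And>j. b $ j \<noteq> 0"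
    and S_inv: "invertible (block_matrix (\<lambda>i j. (if i = j then mat 1 else 0)
        - (h * A $ i $ j) *\<^sub>R (E (c $ i - c $ j) ** J j)))"
    and D: "\<And>i. D i = E (c $ i)
        + h *\<^sub>R (\<Sum>j\<in>UNIV. A $ i $ j *\<^sub>R (E (c $ i - c $ j) ** J j ** D j))"
  shows "det (mat 1 + h *\<^sub>R (\<Sum>i\<in>UNIV. b $ i *\<^sub>R (E (- c $ i) ** J i ** D i))) = 1"
proof -
  define S where "S = block_matrix (\<lambda>i j. (if i = j then mat 1 else 0)
        - (h * A $ i $ j) *\<^sub>R (E (c $ i - c $ j) ** J j))"
  define S' where "S' = block_matrix (\<lambda>i j. (if i = j then mat 1 else 0)
        - (h * A $ i $ j) *\<^sub>R (J i ** E (c $ i - c $ j)))"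
  define T where "T = block_matrix (\<lambda>i j. (if i = j then mat 1 else 0)
        - (h * (A $ i $ j - b $ j)) *\<^sub>R (E (c $ i - c $ j) ** J j))"
  define R where "R = block_row (\<lambda>i. (h * b $ i) *\<^sub>R (E (- c $ i) ** J i))"
  have RD: "R ** block_column D = h *\<^sub>R (\<Sum>i\<in>UNIV. b $ i *\<^sub>R (E (- c $ i) ** J i ** D i))"
    by (simp add: R_def block_row_mult_column scaleR_sum_right flip: scalar_matrix_assoc)
  have SD: "S ** block_column D = block_column (\<lambda>i. E (c $ i))"
  proof -
    have "(\<Sum>j\<in>UNIV. ((if i = j then mat 1 else 0)
        - (h * A $ i $ j) *\<^sub>R (E (c $ i - c $ j) ** J j)) ** D j) = E (c $ i)" for i
    proof -
      have "((if i = j then mat 1 else 0) - (h * A $ i $ j) *\<^sub>R (E (c $ i - c $ j) ** J j)) ** D j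
          = (if i = j then D j else 0)
            - h *\<^sub>R A $ i $ j *\<^sub>R (E (c $ i - c $ j) ** J j ** D j)" for j
        by (simp add: matrix_mul_diff_left flip: scalar_matrix_assoc)
      then have "(\<Sum>j\<in>UNIV. ((if i = j then mat 1 else 0)
          - (h * A $ i $ j) *\<^sub>R (E (c $ i - c $ j) ** J j)) ** D j) =
          D i - h *\<^sub>R (\<Sum>j\<in>UNIV. A $ i $ j *\<^sub>R (E (c $ i - c $ j) ** J j ** D j))"
        by (simp add: sum_subtractf scaleR_sum_right)
      then show ?thesis
        using D[of i] by (simp add: algebra_simps)
    qed
    then show ?thesis by (simp add: S_def block_matrix_mult_column)
  qed
  have "S + block_column (\<lambda>i. E (c $ i)) ** R = T"
  proof -
    have "E (c $ i) ** ((h * b $ j) *\<^sub>R (E (- c $ j) ** J j)) =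
        (h * b $ j) *\<^sub>R (E (c $ i - c $ j) ** J j)" for i j
      using E_add[of "c $ i" "- c $ j"]
      by (simp add: matrix_scalar_ac matrix_mul_assoc flip: scalar_matrix_assoc)
    then show ?thesis
      unfolding S_def R_def T_def block_column_mult_row block_matrix_add
      by (simp add: algebra_simps)
  qed
  moreover have "S + S ** (block_column D ** R) = S ** (mat 1 + block_column D ** R)"
    by (simp add: matrix_add_ldistrib)
  ultimately have "T = S ** (mat 1 + block_column D ** R)"
    by (simp add: matrix_mul_assoc SD)
  then have det_T: "det T = det S * det (mat 1 + R ** block_column D)"
    by (simp add: det_mul weinstein_aronszajn[of R])

  \<comment> \<open>Conjugation by \<open>Q\<close> removes the weights and transposes the blocks.\<close>
  have "det T = det S'"
  proof -
    define Q where "Q = block_diag (\<lambda>i. b $ i *\<^sub>R P)"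
    have "block_diag (\<lambda>i. (1 / b $ i) *\<^sub>R matrix_inv P) ** Q = mat 1"
      using matrix_inv_mult_left[OF P_inv] b_nz
      by (simp add: Q_def block_diag_def[of "\<lambda>i. b $ i *\<^sub>R P"] block_diag_mult matrix_scalar_ac
          if_distrib[where f = "\<lambda>X. _ ** X"] block_diag_one[symmetric] block_diag_def[of "\<lambda>_. mat 1"]
          flip: scalar_matrix_assoc cong: if_cong)
    then have Q: "det Q \<noteq> 0"
      by (metis det_I det_mul mult_zero_right zero_neq_one)
    have PEJ: "P ** (E t ** J j) = - (transpose (J j ** E (- t)) ** P)" for t j
      by (simp add: P_E P_J matrix_mul_assoc matrix_transpose_mul)
        (simp add: P_J matrix_mul_minus_right matrix_mul_minus_left flip: matrix_mul_assoc)
    have coeff: "b $ i * (A $ i $ j - b $ j) = - (b $ j * A $ j $ i)" for i j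
      using sympl by (simp add: symplectic_RK_def algebra_simps)
    have "Q ** T = transpose S' ** Q"
    proof -
      have "b $ i *\<^sub>R P ** ((if i = j then mat 1 else 0)
          - (h * (A $ i $ j - b $ j)) *\<^sub>R (E (c $ i - c $ j) ** J j)) =
        transpose ((if j = i then mat 1 else 0)
          - (h * A $ j $ i) *\<^sub>R (J j ** E (c $ j - c $ i))) ** (b $ j *\<^sub>R P)" (is "?l = ?r") for i j
      proof -
        have "?l = (if i = j then b $ i *\<^sub>R P else 0)
            - (h * (b $ i * (A $ i $ j - b $ j))) *\<^sub>R (P ** (E (c $ i - c $ j) ** J j))"
          by (simp add: matrix_mul_diff_right matrix_scalar_ac mult_ac flip: scalar_matrix_assoc)
        also have "\<dots> = (if i = j then b $ j *\<^sub>R P else 0)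
            - (h * (b $ j * A $ j $ i)) *\<^sub>R (transpose (J j ** E (c $ j - c $ i)) ** P)"
          by (simp add: coeff PEJ)
        also have "\<dots> = ?r"
          by (simp add: transpose_diff transpose_zero transpose_scaleR matrix_mul_diff_left
              scaleR_diff_right matrix_scalar_ac mult_ac flip: scalar_matrix_assoc)
        finally show ?thesis .
      qed
      then show ?thesis
        by (simp only: Q_def T_def S'_def transpose_block_matrix block_diag_mult)
    qed
    then have "det Q * det T = det S' * det Q"
      by (metis det_mul det_transpose)
    then show ?thesis using Q by simp
  qed
  \<comment> \<open>Both matrices are \<open>I\<close> plus a product of \<open>\<Omega>\<close> and \<open>diag (J\<^sub>i)\<close>, in opposite orders.\<close>
  also have "det S' = det S"
  proof -
    define \<Omega> where "\<Omega> = block_matrix (\<lambda>i j. - (h * A $ i $ j) *\<^sub>R E (c $ i - c $ j))"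
    have "S = mat 1 + \<Omega> ** block_diag J"
      by (simp add: S_def \<Omega>_def block_diag_mult mat_one_plus_block_matrix matrix_mul_minus_left
          flip: scalar_matrix_assoc)
    moreover have "S' = mat 1 + block_diag J ** \<Omega>"
      by (simp add: S'_def \<Omega>_def block_diag_mult mat_one_plus_block_matrix matrix_mul_minus_right
          matrix_scalar_ac scalar_matrix_assoc)
    ultimately show ?thesis
      by (simp add: weinstein_aronszajn[of \<Omega>])
  qed
  finally have "det S * det (mat 1 + R ** block_column D) = det S"
    using det_T by simp
  moreover have "det S \<noteq> 0"
    using S_inv by (simp add: S_def invertible_det_nz)
  ultimately show ?thesis by (simp add: RD)
qed

section \<open>Jacobians of the stages and of the step map\<close>

lemma jacobian_eq:
  fixes M :: "real^'n^'m"
  assumes "(F has_derivative (*v) M) (at y)"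
  shows "jacobian F (at y) = M"
  unfolding jacobian_def by (simp flip: frechet_derivative_at[OF assms])

text \<open>
  The stages and the step map have the same shape, so one derivative formula serves both.
\<close>

lemma has_derivative_stage_sum:
  fixes g :: "real^'n \<Rightarrow> real^'n" and k :: "'s::finite \<Rightarrow> real^'n \<Rightarrow> real^'n"
  assumes g: "\<And>x. g differentiable (at x)" and k: "\<And>j. k j differentiable (at y)"
  shows "((\<lambda>y. M *v y + h *\<^sub>R (\<Sum>j\<in>UNIV. a j *\<^sub>R (N j *v g (k j y)))) has_derivative
    (*v) (M + h *\<^sub>R (\<Sum>j\<in>UNIV. a j *\<^sub>R (N j ** jacobian g (at (k j y)) ** jacobian (k j) (at y)))))
    (at y)"
proof -
  let ?J = "\<lambda>j. jacobian g (at (k j y)) ** jacobian (k j) (at y)"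
  have gk: "((\<lambda>y. g (k j y)) has_derivative (\<lambda>v. ?J j *v v)) (at y)" for j
  proof -
    have "(g \<circ> k j has_derivative
        ((*v) (jacobian g (at (k j y))) \<circ> (*v) (jacobian (k j) (at y)))) (at y)"
      using g k by (intro diff_chain_at) (simp_all add: jacobian_works)
    then show ?thesis
      by (simp add: o_def matrix_vector_mul_assoc)
  qed
  have "((\<lambda>y. M *v y + h *\<^sub>R (\<Sum>j\<in>UNIV. a j *\<^sub>R (N j *v g (k j y)))) has_derivative
      (\<lambda>v. M *v v + h *\<^sub>R (\<Sum>j\<in>UNIV. a j *\<^sub>R (N j *v (?J j *v v))))) (at y)"
    by (intro has_derivative_add has_derivative_scaleR_right has_derivative_sum gk
        bounded_linear.has_derivative[OF matrix_vector_mul_bounded_linear] has_derivative_ident)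
  also have "(\<lambda>v. M *v v + h *\<^sub>R (\<Sum>j\<in>UNIV. a j *\<^sub>R (N j *v (?J j *v v)))) =
      (*v) (M + h *\<^sub>R (\<Sum>j\<in>UNIV. a j *\<^sub>R (N j ** ?J j)))"
    by (simp add: fun_eq_iff matrix_vector_mult_add_rdistrib matrix_vector_mul_assoc
        scaleR_matrix_vector sum_matrix_vector)
  finally show ?thesis by (simp add: matrix_mul_assoc)
qed

theorem theorem4p3:
  fixes K P :: "real^'n^'n"
    and f g :: "real^'n \<Rightarrow> real^'n"
    and A :: "real^'s^'s" and b c :: "real^'s"
    and h :: real
    and k :: "'s \<Rightarrow> real^'n \<Rightarrow> real^'n"
  assumes f_def: "\<And>y. f y = K *v y + g y"
    and g_diff: "\<And>y. g differentiable (at y)"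
    and K_exp: "\<And>t. 0 < t \<Longrightarrow> t < 1 \<Longrightarrow> det (mat_exp (t *\<^sub>R K)) \<noteq> - 1"
    and f_div: "divergence_free f"
    and P_inv: "invertible P"
    and f_H: "f \<in> class_H_with P"
    and g_H: "g \<in> class_H_with P"
    and sympl: "symplectic_RK A b"
    and b_nz: "\<And>j. b $ j \<noteq> 0"
    and stages: "SSEI_stages K g h A c k"
    and k_diff: "\<And>i y. k i differentiable (at y)"
    and stage_inv: "\<And>y. invertible (SSEI_stage_matrix K g h A c k y)"
  shows "volume_preserving (SSEI_map K g h b c k)"
proof -
  define E where "E t = mat_exp ((t * h) *\<^sub>R K)" for t
  have anti: "P ** jacobian F (at y) = - transpose (jacobian F (at y)) ** P"
    if "F \<in> class_H_with P" for F y
  proof -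
    have "P ** jacobian F (at y) = P ** jacobian F (at y) ** (matrix_inv P ** P)"
      using matrix_inv_mult_left[OF P_inv] by simp
    also have "\<dots> = (P ** jacobian F (at y) ** matrix_inv P) ** P"
      by (simp only: matrix_mul_assoc)
    also have "\<dots> = - transpose (jacobian F (at y)) ** P"
      using that by (simp add: class_H_with_def)
    finally show ?thesis .
  qed
  \<comment> \<open>The relation passes to \<open>K\<close>, the difference of the Jacobians of \<open>f\<close> and \<open>g\<close>.\<close>
  have K: "P ** K = - transpose K ** P"
  proof -
    have "jacobian f (at 0) = K + jacobian g (at 0)"
    proof (rule jacobian_eq)
      have "((\<lambda>y. K *v y + g y) has_derivative (\<lambda>v. K *v v + jacobian g (at 0) *v v)) (at 0)"
        using g_diff[of 0] unfolding jacobian_works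
        by (intro has_derivative_add bounded_linear_imp_has_derivative matrix_vector_mul_bounded_linear)
      also have "(\<lambda>y. K *v y + g y) = f"
        by (simp add: fun_eq_iff f_def)
      also have "(\<lambda>v. K *v v + jacobian g (at 0) *v v) = (*v) (K + jacobian g (at 0))"
        by (simp add: fun_eq_iff matrix_vector_mult_add_rdistrib)
      finally show "(f has_derivative (*v) (K + jacobian g (at 0))) (at 0)" .
    qed
    then show ?thesis
      using anti[OF f_H, of 0] anti[OF g_H, of 0]
      by (simp add: matrix_add_ldistrib matrix_mul_add_left transpose_add matrix_mul_minus_left
          matrix_mul_diff_left)
  qed
  have E: "E (s + t) = E s ** E t" "P ** E t = transpose (E (- t)) ** P" for s t
    using mat_exp_conj[OF K, of "t * h"]
    by (simp_all add: E_def mat_exp_add distrib_right)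
  have map_deriv: "(SSEI_map K g h b c k has_derivative (*v) (E 1 + h *\<^sub>R (\<Sum>i\<in>UNIV. b $ i *\<^sub>R
      (E (1 - c $ i) ** jacobian g (at (k i y)) ** jacobian (k i) (at y))))) (at y)" for y
    using has_derivative_stage_sum[where g = g and k = k and y = y and M = "E 1" and h = h
        and a = "\<lambda>i. b $ i" and N = "\<lambda>i. E (1 - c $ i)", OF g_diff k_diff]
    by (simp add: E_def SSEI_map_def[abs_def])
  have "det (jacobian (SSEI_map K g h b c k) (at y)) = 1" for y
  proof -
    let ?J = "\<lambda>i. jacobian g (at (k i y))" and ?D = "\<lambda>i. jacobian (k i) (at y)"
    have stage_deriv: "?D i = E (c $ i)
        + h *\<^sub>R (\<Sum>j\<in>UNIV. A $ i $ j *\<^sub>R (E (c $ i - c $ j) ** ?J j ** ?D j))" for i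
    proof (rule jacobian_eq)
      \<comment> \<open>The stage equation is an identity of functions, so \<open>k i\<close> has the derivative of the right side.\<close>
      have stage: "k i = (\<lambda>y. E (c $ i) *v y
          + h *\<^sub>R (\<Sum>j\<in>UNIV. A $ i $ j *\<^sub>R (E (c $ i - c $ j) *v g (k j y))))"
        using stages unfolding SSEI_stages_def E_def by (intro ext) blast
      show "(k i has_derivative (*v) (E (c $ i)
          + h *\<^sub>R (\<Sum>j\<in>UNIV. A $ i $ j *\<^sub>R (E (c $ i - c $ j) ** ?J j ** ?D j)))) (at y)"
        using has_derivative_stage_sum[where g = g and k = k and y = y and M = "E (c $ i)" and h = h
            and a = "\<lambda>j. A $ i $ j" and N = "\<lambda>j. E (c $ i - c $ j)", OF g_diff k_diff]
        by (simp only: stage[symmetric])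
    qed
    have S_inv: "invertible (block_matrix (\<lambda>i j. (if i = j then mat 1 else 0)
        - (h * A $ i $ j) *\<^sub>R (E (c $ i - c $ j) ** ?J j)))"
      using stage_inv[of y] by (simp add: SSEI_stage_matrix_def block_matrix_def E_def)
    have "det (mat 1 + h *\<^sub>R (\<Sum>i\<in>UNIV. b $ i *\<^sub>R (E (- c $ i) ** ?J i ** ?D i))) = 1"
      by (rule det_symplectic_stage_elimination
          [OF E(1) P_inv E(2) anti[OF g_H] sympl b_nz S_inv stage_deriv])
    moreover have "jacobian (SSEI_map K g h b c k) (at y) =
        E 1 ** (mat 1 + h *\<^sub>R (\<Sum>i\<in>UNIV. b $ i *\<^sub>R (E (- c $ i) ** ?J i ** ?D i)))"
    proof -
      have "E (1 - c $ i) = E 1 ** E (- c $ i)" for i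
        using E(1)[of 1 "- c $ i"] by simp
      then show ?thesis
        using jacobian_eq[OF map_deriv[of y]]
        by (simp add: matrix_add_ldistrib matrix_mul_sum_right matrix_scalar_ac matrix_mul_assoc
            scaleR_sum_right mult.commute flip: scalar_matrix_assoc)
    qed
    moreover have "det (E 1) = 1"
      unfolding E_def by (rule det_mat_exp_eq_1[OF P_inv K])
    ultimately show ?thesis by (simp add: det_mul)
  qed
  then show ?thesis
    using map_deriv by (auto simp: volume_preserving_def differentiable_def)
qed

end
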